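(* A connected lattice path matroid that is not a generalized Catalan matroid is a notch matroid if and only if it has a circuit-hyperplane. Moreover, relaxing any circuit-hyperplane of a lattice path matroid yields a generalized Catalan matroid.
   Context: Lattice paths start at $(0,0)$ and use steps $E=(1,0)$ and $N=(0,1)$, written as words in $\{E,N\}$. For lattice paths $P,Q$ from $(0,0)$ to $(m,r)$ with $P$ never going above $Q$, let $\mathcal{P}$ be the set of lattice paths from $(0,0)$ to $(m,r)$ going neither above $Q$ nor below $P$, and for $1\le i\le r$ let $N_i=\{j:\text{step } j \text{ is the } i\text{-th North step of some path in }\mathcal{P}\}$; $M[P,Q]$ is the transversal matroid on $[m+r]$ with presentation $(N_1,\ldots,N_r)$. A lattice path matroid is a matroid isomorphic to some $M[P,Q]$; a generalized Catalan matroid is one isomorphic to some $M[E^mN^r,Q]$; a notch matroid is one isomorphic to some $M[E^mN^r,Q]$ or $M[E^{m-1}NEN^{r-1},Q]$. A circuit-hyperplane is a circuit that is also a hyperplane; relaxing a circuit-hyperplane $H$ of $M$ gives the matroid whose bases are those of $M$ together with $H$. *)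

theory Defs
  imports Main
begin

section \<open>Matroids\<close>

record 'a set_system =
  ground :: "'a set"
  indep :: "'a set set"

definition matroid :: "'a set_system \<Rightarrow> bool" where
  "matroid M \<longleftrightarrow>
     finite (ground M) \<and>
     indep M \<subseteq> Pow (ground M) \<and>
     {} \<in> indep M \<and>
     (\<forall>X\<in>indep M. \<forall>Y. Y \<subseteq> X \<longrightarrow> Y \<in> indep M) \<and>
     (\<forall>X\<in>indep M. \<forall>Y\<in>indep M. card X < card Y \<longrightarrow> (\<exists>y\<in>Y - X. insert y X \<in> indep M))"

definition isomorphic :: "'a set_system \<Rightarrow> 'b set_system \<Rightarrow> bool" where
  "isomorphic M M' \<longleftrightarrow>
     (\<exists>\<phi>. bij_betw \<phi> (ground M) (ground M') \<and>
          (\<forall>X. X \<subseteq> ground M \<longrightarrow> (X \<in> indep M \<longleftrightarrow> \<phi> ` X \<in> indep M')))"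

definition basis :: "'a set_system \<Rightarrow> 'a set \<Rightarrow> bool" where
  "basis M B \<longleftrightarrow> B \<in> indep M \<and> (\<forall>X\<in>indep M. B \<subseteq> X \<longrightarrow> X = B)"

definition circuit :: "'a set_system \<Rightarrow> 'a set \<Rightarrow> bool" where
  "circuit M C \<longleftrightarrow> C \<subseteq> ground M \<and> C \<notin> indep M \<and> (\<forall>X. X \<subset> C \<longrightarrow> X \<in> indep M)"

definition rank :: "'a set_system \<Rightarrow> 'a set \<Rightarrow> nat" where
  "rank M X = Max (card ` {Y \<in> indep M. Y \<subseteq> X})"

definition flat :: "'a set_system \<Rightarrow> 'a set \<Rightarrow> bool" where
  "flat M F \<longleftrightarrow> F \<subseteq> ground M \<and> (\<forall>x\<in>ground M - F. rank M F < rank M (insert x F))"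

definition hyperplane :: "'a set_system \<Rightarrow> 'a set \<Rightarrow> bool" where
  "hyperplane M H \<longleftrightarrow> flat M H \<and> rank M H + 1 = rank M (ground M)"

definition circuit_hyperplane :: "'a set_system \<Rightarrow> 'a set \<Rightarrow> bool" where
  "circuit_hyperplane M H \<longleftrightarrow> circuit M H \<and> hyperplane M H"

definition connected_matroid :: "'a set_system \<Rightarrow> bool" where
  "connected_matroid M \<longleftrightarrow>
     (\<forall>x\<in>ground M. \<forall>y\<in>ground M. x \<noteq> y \<longrightarrow> (\<exists>C. circuit M C \<and> x \<in> C \<and> y \<in> C))"

definition relaxation :: "'a set_system \<Rightarrow> 'a set \<Rightarrow> 'a set_system" where
  "relaxation M H =
     \<lparr>ground = ground M, indep = {X. \<exists>B. (basis M B \<or> B = H) \<and> X \<subseteq> B}\<rparr>"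

text \<open>The independent sets are the partial transversals of the family \<open>(A i)\<close>, \<open>i \<in> J\<close>.\<close>

definition transversal_matroid :: "'a set \<Rightarrow> 'i set \<Rightarrow> ('i \<Rightarrow> 'a set) \<Rightarrow> 'a set_system" where
  "transversal_matroid S J A =
     \<lparr>ground = S,
      indep = {X. X \<subseteq> S \<and> (\<exists>f. inj_on f X \<and> f ` X \<subseteq> J \<and> (\<forall>x\<in>X. x \<in> A (f x)))}\<rparr>"


section \<open>Lattice paths\<close>

datatype step = East | North

type_synonym path = "step list"

definition endpoint :: "path \<Rightarrow> nat \<times> nat" where
  "endpoint w = (count_list w East, count_list w North)"

definition height :: "path \<Rightarrow> nat \<Rightarrow> nat" where
  "height w k = count_list (take k w) North"

text \<open>
  After \<open>k\<close> steps both paths are on the antidiagonal \<open>x + y = k\<close>, so \<open>P\<close> never goes above \<open>Q\<close>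
  iff on each antidiagonal the point of \<open>P\<close> is at most as high as that of \<open>Q\<close>.
\<close>

definition never_above :: "path \<Rightarrow> path \<Rightarrow> bool" where
  "never_above P Q \<longleftrightarrow> (\<forall>k. height P k \<le> height Q k)"

definition bounding_paths :: "path \<Rightarrow> path \<Rightarrow> bool" where
  "bounding_paths P Q \<longleftrightarrow> endpoint P = endpoint Q \<and> never_above P Q"

definition paths_between :: "path \<Rightarrow> path \<Rightarrow> path set" where
  "paths_between P Q = {w. endpoint w = endpoint P \<and> never_above P w \<and> never_above w Q}"

text \<open>Steps are numbered from 1, whereas list positions start at 0.\<close>

definition is_north_step :: "path \<Rightarrow> nat \<Rightarrow> nat \<Rightarrow> bool" where
  "is_north_step w i j \<longleftrightarrow> 1 \<le> j \<and> j \<le> length w \<and> w ! (j - 1) = North \<and> height w j = i"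

definition north_positions :: "path \<Rightarrow> path \<Rightarrow> nat \<Rightarrow> nat set" where
  "north_positions P Q i = {j. \<exists>w\<in>paths_between P Q. is_north_step w i j}"

definition path_matroid :: "path \<Rightarrow> path \<Rightarrow> nat set_system" where
  "path_matroid P Q =
     transversal_matroid {1..length P} {1..count_list P North} (north_positions P Q)"


section \<open>Classes of lattice path matroids\<close>

definition lattice_path_matroid :: "'a set_system \<Rightarrow> bool" where
  "lattice_path_matroid M \<longleftrightarrow>
     matroid M \<and> (\<exists>P Q. bounding_paths P Q \<and> isomorphic M (path_matroid P Q))"

definition catalan_path :: "nat \<Rightarrow> nat \<Rightarrow> path" where
  "catalan_path m r = replicate m East @ replicate r North"

definition notch_path :: "nat \<Rightarrow> nat \<Rightarrow> path" where
  "notch_path m r = replicate (m - 1) East @ [North, East] @ replicate (r - 1) North"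

definition generalized_catalan_matroid :: "'a set_system \<Rightarrow> bool" where
  "generalized_catalan_matroid M \<longleftrightarrow>
     matroid M \<and>
     (\<exists>m r Q. bounding_paths (catalan_path m r) Q \<and>
              isomorphic M (path_matroid (catalan_path m r) Q))"

definition notch_matroid :: "'a set_system \<Rightarrow> bool" where
  "notch_matroid M \<longleftrightarrow>
     matroid M \<and>
     ((\<exists>m r Q. bounding_paths (catalan_path m r) Q \<and>
               isomorphic M (path_matroid (catalan_path m r) Q)) \<or>
      (\<exists>m r Q. 1 \<le> m \<and> 1 \<le> r \<and> bounding_paths (notch_path m r) Q \<and>
               isomorphic M (path_matroid (notch_path m r) Q)))"

end

(* The independent sets of M[P,Q] are the sets X with |X \<inter> (s,t]| \<le> Q(t) - P(s) for all s \<le> t,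
   where P(k), Q(k) are the heights of the paths after k steps.  A circuit-hyperplane H is a set
   of full size that is not a basis although exchanging any h \<in> H for any y \<notin> H gives a basis.
   So H violates one of P(t) \<le> |H \<inter> (0,t]| \<le> Q(t); reversing the ground set, we may assume that it
   is the first.  As every exchange repairs this violation, H lies beyond t and its
   complement within the first t, i.e. H consists of the last r elements, and the exchanged bases then force
   P = E^(m-1) N E N^(r-1).  Lowering P to E^m N^r adds the single basis H.  Conversely, in
   a connected notch matroid the paths meet only at their ends, which makes the last r elements
   a circuit-hyperplane. *)

theory Submission
  imports Defs
begin

section \<open>Circuit-hyperplanes and isomorphisms\<close>

text \<open>Circuit-hyperplanes in a form that involves no rank, so that it transfers easily along isomorphisms.\<close>

definition near_basis :: "'a set_system \<Rightarrow> 'a set \<Rightarrow> bool" where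
  "near_basis M H \<longleftrightarrow> H \<subset> ground M \<and> H \<notin> indep M \<and> (\<forall>X\<in>indep M. card X \<le> card H) \<and>
     (\<forall>h\<in>H. \<forall>y\<in>ground M - H. insert y (H - {h}) \<in> indep M)"

text \<open>Keeps the bijection explicit, so that the image of one particular set can be followed;
  \<open>isomorphic\<close> hides it behind an existential.\<close>

definition iso_via :: "('a \<Rightarrow> 'b) \<Rightarrow> 'a set_system \<Rightarrow> 'b set_system \<Rightarrow> bool" where
  "iso_via \<phi> M N \<longleftrightarrow> bij_betw \<phi> (ground M) (ground N) \<and>
     (\<forall>X. X \<subseteq> ground M \<longrightarrow> (X \<in> indep M \<longleftrightarrow> \<phi> ` X \<in> indep N))"

lemma isomorphic_iff: "isomorphic M N \<longleftrightarrow> (\<exists>\<phi>. iso_via \<phi> M N)"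
  by (simp add: isomorphic_def iso_via_def)

section \<open>Rank and circuit-hyperplanes\<close>

lemma matroidD:
  assumes "matroid M"
  shows "finite (ground M)" "\<And>X. X \<in> indep M \<Longrightarrow> X \<subseteq> ground M" "{} \<in> indep M"
    "\<And>X Y. X \<in> indep M \<Longrightarrow> Y \<subseteq> X \<Longrightarrow> Y \<in> indep M"
    "\<And>X Y. X \<in> indep M \<Longrightarrow> Y \<in> indep M \<Longrightarrow> card X < card Y \<Longrightarrow>
      \<exists>y\<in>Y - X. insert y X \<in> indep M"
  using assms unfolding matroid_def by blast+

lemma card_exchange_element:
  assumes "finite H" "h \<in> H" "y \<notin> H"
  shows "card (insert y (H - {h})) = card H"
proof -
  have "card (insert y (H - {h})) = Suc (card (H - {h}))" using assms by simp
  then show ?thesis using card_Suc_Diff1[OF assms(1,2)] by simp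
qed

text \<open>The maximum in \<open>rank\<close> ranges over a finite nonempty set, because the ground
  set is finite and the empty set is independent. From here on \<open>rank\<close> is handled only
  through these two bounds.\<close>

lemma
  assumes "matroid M"
  shows rank_le_iff: "rank M X \<le> k \<longleftrightarrow> (\<forall>Y\<in>indep M. Y \<subseteq> X \<longrightarrow> card Y \<le> k)"
    and le_rank_iff: "k \<le> rank M X \<longleftrightarrow> (\<exists>Y\<in>indep M. Y \<subseteq> X \<and> k \<le> card Y)"
proof -
  let ?I = "{Y \<in> indep M. Y \<subseteq> X}"
  have "?I \<subseteq> Pow (ground M)" using matroidD(2)[OF assms] by blast
  then have "finite ?I" using matroidD(1)[OF assms] by (meson finite_Pow_iff finite_subset)
  moreover have "?I \<noteq> {}" using matroidD(3)[OF assms] by blast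
  ultimately show "rank M X \<le> k \<longleftrightarrow> (\<forall>Y\<in>indep M. Y \<subseteq> X \<longrightarrow> card Y \<le> k)"
    "k \<le> rank M X \<longleftrightarrow> (\<exists>Y\<in>indep M. Y \<subseteq> X \<and> k \<le> card Y)"
    unfolding rank_def by (auto simp: Max_ge_iff)
qed

lemma rank_circuit:
  assumes "matroid M" "circuit M C"
  shows "Suc (rank M C) = card C"
proof -
  have C: "C \<subseteq> ground M" "C \<notin> indep M" "\<And>X. X \<subset> C \<Longrightarrow> X \<in> indep M"
    using assms(2) unfolding circuit_def by auto
  have fin: "finite C" using C(1) matroidD(1)[OF assms(1)] by (rule finite_subset)
  obtain c where c: "c \<in> C" using C(2) matroidD(3)[OF assms(1)] by (cases "C = {}") auto
  have "C - {c} \<in> indep M" using C(3) c by blast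
  then have "card C - 1 \<le> rank M C"
    unfolding le_rank_iff[OF assms(1)] using c fin
    by (metis Diff_subset card_Diff_singleton order_refl)
  moreover have "rank M C \<le> card C - 1"
    unfolding rank_le_iff[OF assms(1)]
  proof (intro ballI impI)
    fix Y assume "Y \<in> indep M" "Y \<subseteq> C"
    then have "Y \<subset> C" using C(2) by blast
    then show "card Y \<le> card C - 1" using psubset_card_mono[OF fin, of Y] by simp
  qed
  moreover have "card C > 0" using c fin card_gt_0_iff by blast
  ultimately show ?thesis by linarith
qed

text \<open>A circuit has rank one below its size, so a circuit-hyperplane has exactly as many
  elements as a basis. Flatness then says that adding any outside element raises the rank to full,
  and augmenting \<open>H - {h}\<close> turns this into the exchange property. Conversely, the
  exchanged sets witness both the independence of the proper subsets of \<open>H\<close> and the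
  increase in rank.\<close>

lemma circuit_hyperplane_iff:
  assumes "matroid M"
  shows "circuit_hyperplane M H \<longleftrightarrow> near_basis M H"
proof
  note M = matroidD[OF assms]
  assume ch: "circuit_hyperplane M H"
  have circ: "circuit M H" and fl: "flat M H" and rk: "rank M H + 1 = rank M (ground M)"
    using ch unfolding circuit_hyperplane_def hyperplane_def by auto
  have H: "H \<subseteq> ground M" "H \<notin> indep M" "\<And>X. X \<subset> H \<Longrightarrow> X \<in> indep M"
    using circ unfolding circuit_def by auto
  have fin: "finite H" using H(1) M(1) by (rule finite_subset)
  have card: "Suc (rank M H) = card H" using rank_circuit[OF assms circ] .
  have "H \<noteq> ground M" using rk by auto
  moreover have "card X \<le> card H" if "X \<in> indep M" for X
    using rank_le_iff[OF assms, of "ground M" "card H"] that M(2) card rk by auto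
  moreover have "insert y (H - {h}) \<in> indep M" if h: "h \<in> H" and y: "y \<in> ground M - H" for h y
  proof -
    have "rank M H < rank M (insert y H)" using fl y unfolding flat_def by blast
    then have "card H \<le> rank M (insert y H)" using card by linarith
    then obtain Y where Y: "Y \<in> indep M" "Y \<subseteq> insert y H" "card H \<le> card Y"
      unfolding le_rank_iff[OF assms] by blast
    have I: "H - {h} \<in> indep M" using H(3) h by blast
    have "card (H - {h}) < card Y" using Y(3) card_Diff1_less[OF fin h] by linarith
    then obtain z where z: "z \<in> Y - (H - {h})" "insert z (H - {h}) \<in> indep M"
      using M(5)[OF I Y(1)] by blast
    \<comment> \<open>Adding \<open>h\<close> back would restore the dependent set \<open>H\<close>;
      since \<open>Y\<close> lies in \<open>insert y H\<close>, only \<open>z = y\<close>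
      remains.\<close>
    then have "z \<noteq> h" using H(2) h by (metis insert_Diff)
    then show ?thesis using z Y(2) by blast
  qed
  ultimately show "near_basis M H" unfolding near_basis_def using H by blast
next
  note M = matroidD[OF assms]
  assume "near_basis M H"
  then have H: "H \<subset> ground M" "H \<notin> indep M" "\<And>X. X \<in> indep M \<Longrightarrow> card X \<le> card H"
    "\<And>h y. h \<in> H \<Longrightarrow> y \<in> ground M - H \<Longrightarrow> insert y (H - {h}) \<in> indep M"
    unfolding near_basis_def by auto
  have fin: "finite H" using H(1) M(1) by (meson finite_subset psubset_imp_subset)
  obtain h where h: "h \<in> H" using H(2) M(3) by (cases "H = {}") auto
  obtain e where e: "e \<in> ground M - H" using H(1) by blast
  \<comment> \<open>A proper subset that misses \<open>x\<close> survives inside the exchange of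
    \<open>x\<close> for \<open>e\<close>.\<close>
  have "X \<in> indep M" if X: "X \<subset> H" for X
  proof -
    obtain x where "x \<in> H" "x \<notin> X" using X by blast
    then show ?thesis using M(4)[OF H(4)[OF _ e], of x X] X by blast
  qed
  then have circ: "circuit M H" unfolding circuit_def using H by blast
  have card: "Suc (rank M H) = card H" using rank_circuit[OF assms circ] .
  have ge: "card H \<le> rank M (insert y H)" if "y \<in> ground M - H" for y
  proof -
    have "card (insert y (H - {h})) = card H"
      using that h fin by (intro card_exchange_element) auto
    then show ?thesis unfolding le_rank_iff[OF assms] using H(4)[OF h that]
      by (metis Diff_subset insert_mono order_refl)
  qed
  have "flat M H" unfolding flat_def using H(1) ge card by fastforce
  moreover have "rank M (ground M) \<le> card H" unfolding rank_le_iff[OF assms] using H(3) by blast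
  moreover have "card H \<le> rank M (ground M)"
  proof -
    have "rank M (insert e H) \<le> rank M (ground M)"
      using e H(1) le_rank_iff[OF assms, of "rank M (insert e H)"]
      by (meson DiffD1 insert_subset order_refl psubset_imp_subset subset_trans)
    then show ?thesis using ge[OF e] by linarith
  qed
  ultimately show "circuit_hyperplane M H"
    unfolding circuit_hyperplane_def hyperplane_def using circ card by simp
qed

section \<open>Relaxation\<close>

lemma indep_extends_to_basis:
  assumes "matroid M" "X \<in> indep M"
  shows "\<exists>B. basis M B \<and> X \<subseteq> B"
proof -
  have "indep M \<subseteq> Pow (ground M)" using matroidD(2)[OF assms(1)] by blast
  then have "finite (indep M)"
    using matroidD(1)[OF assms(1)] by (meson finite_Pow_iff finite_subset)
  then obtain B where "B \<in> indep M" "X \<subseteq> B" "\<forall>Y\<in>indep M. B \<subseteq> Y \<longrightarrow> B = Y"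
    using finite_has_maximal2[of "indep M" X] assms(2) by metis
  then show ?thesis unfolding basis_def by blast
qed

text \<open>All proper subsets of a circuit are independent already, so closing the enlarged family
  of bases under subsets adds nothing but \<open>H\<close>.\<close>

lemma indep_relaxation:
  assumes "matroid M" "circuit M H"
  shows "indep (relaxation M H) = insert H (indep M)"
proof (intro subset_antisym subsetI)
  fix X assume "X \<in> indep (relaxation M H)"
  then obtain B where "basis M B \<or> B = H" "X \<subseteq> B" unfolding relaxation_def by auto
  then show "X \<in> insert H (indep M)"
    using matroidD(4)[OF assms(1), of B X] assms(2) unfolding basis_def circuit_def by blast
next
  fix X assume "X \<in> insert H (indep M)"
  then show "X \<in> indep (relaxation M H)"
    using indep_extends_to_basis[OF assms(1), of X] unfolding relaxation_def by auto
qed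

lemma matroid_relaxation:
  assumes "matroid M" "circuit_hyperplane M H"
  shows "matroid (relaxation M H)"
proof -
  note M = matroidD[OF assms(1)]
  have circ: "circuit M H" using assms(2) unfolding circuit_hyperplane_def by simp
  have nb: "near_basis M H" using assms circuit_hyperplane_iff by blast
  then have H: "H \<subset> ground M" "H \<notin> indep M" "\<And>X. X \<in> indep M \<Longrightarrow> card X \<le> card H"
    "\<And>h y. h \<in> H \<Longrightarrow> y \<in> ground M - H \<Longrightarrow> insert y (H - {h}) \<in> indep M"
    unfolding near_basis_def by auto
  have fin: "finite H" using H(1) M(1) by (meson finite_subset psubset_imp_subset)
  have aug: "\<exists>y\<in>Y - X. insert y X \<in> insert H (indep M)"
    if X: "X \<in> insert H (indep M)" and Y: "Y \<in> insert H (indep M)" and lt: "card X < card Y" for X Y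
  proof -
    \<comment> \<open>The smaller set cannot be \<open>H\<close>, as no set in the enlarged family
      is larger than \<open>H\<close>.\<close>
    have XI: "X \<in> indep M" using X Y lt H(3) by fastforce
    consider "Y \<in> indep M" | "Y = H" "X \<subseteq> H" | "Y = H" "\<not> X \<subseteq> H" using Y by blast
    then show ?thesis
    proof cases
      case 1
      then show ?thesis using M(5)[OF XI _ lt] by blast
    next
      case 2
      then have "X \<subset> H" using lt by auto
      then obtain y where y: "y \<in> H - X" by blast
      then have "insert y X \<subseteq> H" using 2(2) by blast
      then have "insert y X \<in> insert H (indep M)"
        using circ unfolding circuit_def by (metis insert_iff psubsetI)
      then show ?thesis unfolding 2(1) using y by blast
    next
      case 3
      \<comment> \<open>The dependent set \<open>H\<close> is replaced by an exchange of the same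
        size. Since the element \<open>e\<close> brought in belongs to \<open>X\<close>, whatever
        the augmentation adds comes from \<open>H\<close>.\<close>
      obtain e where e: "e \<in> X" "e \<notin> H" using 3(2) by blast
      obtain h where h: "h \<in> H" using 3(1) lt by (cases "H = {}") auto
      have B: "insert e (H - {h}) \<in> indep M" using H(4) h e M(2)[OF XI] by blast
      have "card (insert e (H - {h})) = card H"
        using e h fin by (intro card_exchange_element)
      then have "\<exists>y\<in>insert e (H - {h}) - X. insert y X \<in> indep M"
        using M(5)[OF XI B] lt 3(1) by simp
      then show ?thesis unfolding 3(1) using e(1) by blast
    qed
  qed
  show ?thesis
    unfolding matroid_def indep_relaxation[OF assms(1) circ]
  proof (intro conjI)
    show "finite (ground (relaxation M H))" using M(1) by (simp add: relaxation_def)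
    show "insert H (indep M) \<subseteq> Pow (ground (relaxation M H))"
      using M(2) H(1) by (auto simp: relaxation_def)
    show "\<forall>X\<in>insert H (indep M). \<forall>Y. Y \<subseteq> X \<longrightarrow> Y \<in> insert H (indep M)"
      using M(4) circ unfolding circuit_def by blast
    show "{} \<in> insert H (indep M)" using M(3) by simp
  qed (use aug in simp)
qed

section \<open>Transfer along isomorphisms\<close>

lemma iso_viaD:
  assumes "iso_via \<phi> M N"
  shows "bij_betw \<phi> (ground M) (ground N)" "inj_on \<phi> (ground M)" "\<phi> ` ground M = ground N"
    "\<And>X. X \<subseteq> ground M \<Longrightarrow> \<phi> ` X \<in> indep N \<longleftrightarrow> X \<in> indep M"
    "\<And>X. X \<subseteq> ground M \<Longrightarrow> card (\<phi> ` X) = card X"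
proof -
  show inj: "inj_on \<phi> (ground M)" and "bij_betw \<phi> (ground M) (ground N)"
    "\<phi> ` ground M = ground N"
    "\<And>X. X \<subseteq> ground M \<Longrightarrow> \<phi> ` X \<in> indep N \<longleftrightarrow> X \<in> indep M"
    using assms unfolding iso_via_def bij_betw_def by auto
  show "card (\<phi> ` X) = card X" if "X \<subseteq> ground M" for X
    using card_image[OF inj_on_subset[OF inj that]] .
qed

lemma iso_via_trans:
  assumes "iso_via \<phi> M N" "iso_via \<psi> N L"
  shows "iso_via (\<psi> \<circ> \<phi>) M L"
  unfolding iso_via_def
proof (intro conjI allI impI)
  show "bij_betw (\<psi> \<circ> \<phi>) (ground M) (ground L)"
    using iso_viaD(1)[OF assms(1)] iso_viaD(1)[OF assms(2)] by (rule bij_betw_trans)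
  fix X assume X: "X \<subseteq> ground M"
  then have "\<phi> ` X \<subseteq> ground N" using iso_viaD(3)[OF assms(1)] by blast
  then show "X \<in> indep M \<longleftrightarrow> (\<psi> \<circ> \<phi>) ` X \<in> indep L"
    using iso_viaD(4)[OF assms(1) X] iso_viaD(4)[OF assms(2), of "\<phi> ` X"] by (simp add: image_comp)
qed

text \<open>The inclusions in \<open>Pow\<close> make \<open>indep N\<close> exactly the family of
  images of members of \<open>indep M\<close>, which carries over the bound on cardinalities. They
  hold for \<open>path_matroid\<close> by construction.\<close>

lemma near_basis_iso:
  assumes iso: "iso_via \<phi> M N" and M: "indep M \<subseteq> Pow (ground M)" and N: "indep N \<subseteq> Pow (ground N)"
    and H: "H \<subseteq> ground M"
  shows "near_basis N (\<phi> ` H) \<longleftrightarrow> near_basis M H"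
proof -
  note I = iso_viaD[OF iso]
  have 1: "\<phi> ` H \<subset> ground N \<longleftrightarrow> H \<subset> ground M"
    unfolding psubset_eq I(3)[symmetric] inj_on_image_eq_iff[OF I(2) H subset_refl]
    using H by (simp add: image_mono)
  have ind: "indep N = image \<phi> ` indep M"
  proof
    show "indep N \<subseteq> image \<phi> ` indep M"
    proof
      fix Y assume Y: "Y \<in> indep N"
      then obtain X where "X \<subseteq> ground M" "Y = \<phi> ` X" using N I(3) by (metis PowD subsetD subset_imageE)
      then show "Y \<in> image \<phi> ` indep M" using I(4) Y by blast
    qed
  qed (use M I(4) in blast)
  have 2: "(\<forall>X\<in>indep N. card X \<le> card (\<phi> ` H)) \<longleftrightarrow> (\<forall>X\<in>indep M. card X \<le> card H)"
  proof -
    have "card (\<phi> ` X) = card X" if "X \<in> indep M" for X using I(5) M that by blast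
    then show ?thesis unfolding ind I(5)[OF H] by simp
  qed
  have diff: "ground N - \<phi> ` H = \<phi> ` (ground M - H)"
    using inj_on_image_set_diff[OF I(2) Diff_subset H] I(3) by simp
  have "insert (\<phi> y) (\<phi> ` H - {\<phi> h}) \<in> indep N \<longleftrightarrow> insert y (H - {h}) \<in> indep M"
    if "h \<in> H" "y \<in> ground M - H" for h y
  proof -
    have sub: "insert y (H - {h}) \<subseteq> ground M" using that H by blast
    have "\<phi> ` (H - {h}) = \<phi> ` H - {\<phi> h}"
      using inj_on_image_set_diff[OF I(2), of H "{h}"] H that by auto
    then show ?thesis using I(4)[OF sub] by simp
  qed
  then have 3: "(\<forall>h\<in>\<phi> ` H. \<forall>y\<in>ground N - \<phi> ` H. insert y (\<phi> ` H - {h}) \<in> indep N) \<longleftrightarrow>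
      (\<forall>h\<in>H. \<forall>y\<in>ground M - H. insert y (H - {h}) \<in> indep M)"
    unfolding diff by auto
  show ?thesis unfolding near_basis_def 1 2 3 I(4)[OF H] ..
qed

lemma circuit_iso:
  assumes iso: "iso_via \<phi> M N" and C: "circuit M C"
  shows "circuit N (\<phi> ` C)"
proof -
  note I = iso_viaD[OF iso]
  have C': "C \<subseteq> ground M" "C \<notin> indep M" "\<And>X. X \<subset> C \<Longrightarrow> X \<in> indep M"
    using C unfolding circuit_def by auto
  have "Y \<in> indep N" if Y: "Y \<subset> \<phi> ` C" for Y
  proof -
    obtain X where X: "X \<subseteq> C" "Y = \<phi> ` X" using Y by (meson psubset_imp_subset subset_imageE)
    then have "X \<subset> C" using Y by blast
    then show ?thesis using C'(3) I(4)[of X] C'(1) X by blast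
  qed
  moreover have "\<phi> ` C \<subseteq> ground N" using C'(1) I(3) by blast
  moreover have "\<phi> ` C \<notin> indep N" using C'(1,2) I(4) by simp
  ultimately show ?thesis unfolding circuit_def by simp
qed

lemma connected_matroid_iso:
  assumes "iso_via \<phi> M N" "connected_matroid M"
  shows "connected_matroid N"
  unfolding connected_matroid_def
proof (intro ballI impI)
  fix x' y' assume "x' \<in> ground N" "y' \<in> ground N" and ne: "x' \<noteq> y'"
  then obtain x y where "x \<in> ground M" "y \<in> ground M" "x' = \<phi> x" "y' = \<phi> y"
    using iso_viaD(3)[OF assms(1)] by blast
  then show "\<exists>C. circuit N C \<and> x' \<in> C \<and> y' \<in> C"
    using assms(2) circuit_iso[OF assms(1)] ne unfolding connected_matroid_def by (metis imageI)
qed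

section \<open>Independence in lattice path matroids\<close>

lemma height_0 [simp]: "height w 0 = 0"
  by (simp add: height_def)

lemma height_Suc:
  "k < length w \<Longrightarrow> height w (Suc k) = height w k + (if w ! k = North then 1 else 0)"
  by (simp add: height_def take_Suc_conv_app_nth)

lemma height_beyond: "length w \<le> k \<Longrightarrow> height w k = count_list w North"
  by (simp add: height_def)

lemma height_step: "height w k \<le> height w (Suc k)" "height w (Suc k) \<le> Suc (height w k)"
  by (cases "k < length w"; simp add: height_Suc height_beyond)+

lemma height_mono: "j \<le> k \<Longrightarrow> height w j \<le> height w k"
  by (rule lift_Suc_mono_le[of "height w"]) (simp_all add: height_step)

lemma height_le_count: "height w k \<le> count_list w North"
  using height_mono[of k "max k (length w)" w] by (simp add: height_beyond)

lemma count_steps: "count_list w East + count_list w North = length w"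
proof (induction w)
  case (Cons a w)
  then show ?case by (cases a) auto
qed simp

lemma path_eqI:
  assumes "length v = length w" "\<And>k. k \<le> length v \<Longrightarrow> height v k = height w k"
  shows "v = w"
proof (rule nth_equalityI[OF assms(1)])
  fix k assume k: "k < length v"
  then have "(v ! k = North) = (w ! k = North)"
    using assms(2)[of k] assms(2)[of "Suc k"] assms(1) by (auto simp: height_Suc split: if_splits)
  then show "v ! k = w ! k" by (metis step.exhaust)
qed

text \<open>Lets a path be specified by its height profile, which is easier to interpolate between
  two given paths than a word.\<close>

lemma path_of_heights:
  assumes "h 0 = 0" "\<And>k. k < n \<Longrightarrow> h (Suc k) = h k \<or> h (Suc k) = Suc (h k)"
  shows "\<exists>w. length w = n \<and> (\<forall>k\<le>n. height w k = h k)"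
  using assms(2)
proof (induction n)
  case 0
  then show ?case using assms(1) by simp
next
  case (Suc n)
  then obtain w where w: "length w = n" "\<forall>k\<le>n. height w k = h k" by auto
  define v where "v = w @ [if h (Suc n) = h n then East else North]"
  have "height v k = h k" if "k \<le> n" for k
    using that w by (simp add: v_def height_def)
  moreover have "height v (Suc n) = h (Suc n)"
    using Suc.prems[of n] w by (auto simp: v_def height_def)
  ultimately show ?case using w(1) by (intro exI[of _ v]) (auto simp: v_def le_Suc_eq)
qed

section \<open>Pairs of bounding paths and their North steps\<close>

lemma bounding_pathsD:
  assumes "bounding_paths P Q"
  shows "length Q = length P" "count_list Q North = count_list P North"
    "height P k \<le> height Q k"
proof -
  have "count_list P East = count_list Q East" "count_list P North = count_list Q North"
    using assms unfolding bounding_paths_def endpoint_def by simp_all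
  then show "length Q = length P" "count_list Q North = count_list P North"
    using count_steps[of P] count_steps[of Q] by linarith+
  show "height P k \<le> height Q k" using assms unfolding bounding_paths_def never_above_def by simp
qed

lemma bounding_pathsI:
  assumes "length P = length Q" "count_list P North = count_list Q North"
    "\<And>k. k \<le> length Q \<Longrightarrow> height P k \<le> height Q k"
  shows "bounding_paths P Q"
proof -
  have "height P k \<le> height Q k" for k
    using assms by (cases "k \<le> length Q") (auto simp: height_beyond)
  then show ?thesis
    using assms count_steps[of P] count_steps[of Q]
    unfolding bounding_paths_def endpoint_def never_above_def by auto
qed

lemma paths_between_iff:
  assumes "bounding_paths P Q"
  shows "w \<in> paths_between P Q \<longleftrightarrow> bounding_paths P w \<and> bounding_paths w Q"
  using assms unfolding paths_between_def bounding_paths_def by auto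

text \<open>This removes the quantifier over paths from the presentation. The bounds are necessary
  because an \<open>i\<close>-th North step climbs from \<open>i - 1\<close> to \<open>i\<close>
  between the two paths; they suffice because a level line with one jump at \<open>j\<close>,
  clamped between \<open>P\<close> and \<open>Q\<close>, is itself a path.\<close>

lemma north_positions_iff:
  assumes PQ: "bounding_paths P Q"
  shows "j \<in> north_positions P Q i \<longleftrightarrow>
    1 \<le> j \<and> j \<le> length P \<and> height P (j - 1) < i \<and> i \<le> height Q j"
proof
  assume "j \<in> north_positions P Q i"
  then obtain w where w: "bounding_paths P w" "bounding_paths w Q" "is_north_step w i j"
    by (auto simp: north_positions_def paths_between_iff[OF PQ])
  then have j: "1 \<le> j" "j \<le> length w" "w ! (j - 1) = North" "height w j = i"
    unfolding is_north_step_def by auto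
  then have "i = Suc (height w (j - 1))" using height_Suc[of "j - 1" w] by auto
  then show "1 \<le> j \<and> j \<le> length P \<and> height P (j - 1) < i \<and> i \<le> height Q j"
    using j bounding_pathsD[OF w(1)] bounding_pathsD(3)[OF w(2), of j]
    by (auto simp: less_Suc_eq_le)
next
  assume a: "1 \<le> j \<and> j \<le> length P \<and> height P (j - 1) < i \<and> i \<le> height Q j"
  note b = bounding_pathsD[OF PQ]
  obtain j' where j': "j = Suc j'" using a by (cases j) auto
  \<comment> \<open>The level \<open>i - 1\<close> before \<open>j\<close> and \<open>i\<close> from
    \<open>j\<close> on, clamped between the two heights.\<close>
  define h where "h k = (if k < j then max (height P k) (min (height Q k) (i - 1))
     else max (height P k) (min (height Q k) i))" for k
  have hj': "h j' = i - 1"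
    using a j' height_step(2)[of Q j'] by (auto simp: h_def)
  have hj: "h j = i"
    using a j' height_step(2)[of P j'] by (auto simp: h_def)
  \<comment> \<open>Away from \<open>j\<close> the level is constant, so the clamped value inherits
    steps of size at most one from \<open>P\<close> and \<open>Q\<close>. At \<open>j\<close> the
    clamping is inactive on both sides.\<close>
  have step: "h (Suc k) = h k \<or> h (Suc k) = Suc (h k)" for k
  proof (cases "Suc k = j")
    case True
    then show ?thesis using hj hj' a j' by auto
  next
    case False
    then have eq: "Suc k < j \<longleftrightarrow> k < j" by auto
    show ?thesis
      using height_step[of P k] height_step[of Q k] unfolding h_def eq max_def min_def by auto
  qed
  obtain w where w: "length w = length P" "\<forall>k\<le>length P. height w k = h k"
    using path_of_heights[of h "length P"] step j' by (auto simp: h_def)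
  have le: "height P k \<le> h k" "h k \<le> height Q k" for k
    using b(3)[of k] by (auto simp: h_def)
  have cnt: "count_list w North = count_list P North"
    using w le[of "length P"] height_beyond[of w "length P"] height_beyond[of P "length P"]
      height_beyond[of Q "length P"] b by auto
  have "bounding_paths P w" "bounding_paths w Q"
    using w le b cnt by (auto intro!: bounding_pathsI)
  moreover have "is_north_step w i j"
    unfolding is_north_step_def using a w hj hj' j' height_Suc[of j' w] by (auto split: if_splits)
  ultimately show "j \<in> north_positions P Q i"
    by (auto simp: north_positions_def paths_between_iff[OF PQ])
qed

section \<open>The interval criterion for independence\<close>

lemma ground_path_matroid [simp]: "ground (path_matroid P Q) = {1..length P}"
  by (simp add: path_matroid_def transversal_matroid_def)

lemma indep_path_matroid_subset: "indep (path_matroid P Q) \<subseteq> Pow (ground (path_matroid P Q))"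
  by (auto simp: path_matroid_def transversal_matroid_def)

text \<open>Hall's condition for interval-shaped sets with monotone endpoints. Elements in
  \<open>{s<..t}\<close> can only use indices in \<open>{height P s<..height Q t}\<close>;
  conversely, a greedy increasing assignment works.\<close>

lemma indep_path_matroid_iff:
  assumes PQ: "bounding_paths P Q"
  shows "X \<in> indep (path_matroid P Q) \<longleftrightarrow> X \<subseteq> {1..length P} \<and>
    (\<forall>s t. s \<le> t \<longrightarrow> t \<le> length P \<longrightarrow> card (X \<inter> {s<..t}) + height P s \<le> height Q t)"
    (is "_ \<longleftrightarrow> _ \<and> ?R")
proof -
  note b = bounding_pathsD[OF PQ]
  let ?A = "\<lambda>f x. height P (x - 1) < f x \<and> f x \<le> height Q x"
  have "X \<in> indep (path_matroid P Q) \<longleftrightarrow> X \<subseteq> {1..length P} \<and>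
      (\<exists>f. inj_on f X \<and> f ` X \<subseteq> {1..count_list P North} \<and> (\<forall>x\<in>X. ?A f x))"
    by (fastforce simp: path_matroid_def transversal_matroid_def north_positions_iff[OF PQ])
  moreover have "(\<exists>f. inj_on f X \<and> f ` X \<subseteq> {1..count_list P North} \<and> (\<forall>x\<in>X. ?A f x)) \<longleftrightarrow> ?R"
    if X: "X \<subseteq> {1..length P}"
  proof
    assume "\<exists>f. inj_on f X \<and> f ` X \<subseteq> {1..count_list P North} \<and> (\<forall>x\<in>X. ?A f x)"
    then obtain f where f: "inj_on f X" "\<And>x. x \<in> X \<Longrightarrow> ?A f x" by blast
    show ?R
    proof (intro allI impI)
      fix s t assume st: "s \<le> t" "t \<le> length P"
      have "f x \<in> {height P s<..height Q t}" if "x \<in> X \<inter> {s<..t}" for x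
      proof -
        have "s \<le> x - 1" "x \<le> t" using that by auto
        then show ?thesis
          using f(2)[of x] height_mono[of s "x - 1" P] height_mono[of x t Q] that by simp
      qed
      then have "card (f ` (X \<inter> {s<..t})) \<le> card {height P s<..height Q t}"
        by (intro card_mono) auto
      moreover have "card (f ` (X \<inter> {s<..t})) = card (X \<inter> {s<..t})"
        by (intro card_image inj_on_subset[OF f(1)]) auto
      \<comment> \<open>Guards the truncated subtraction in the cardinality of the index
        interval.\<close>
      moreover have "height P s \<le> height Q t"
        using height_mono[OF st(1), of P] b(3)[of t] by linarith
      ultimately show "card (X \<inter> {s<..t}) + height P s \<le> height Q t" by simp
    qed
  next
    assume R: ?R
    \<comment> \<open>The smallest value that a strictly increasing system of representatives can take at \<open>x\<close>.\<close>
    define f where "f x = Max ((\<lambda>s. height P s + card (X \<inter> {s<..x})) ` {..<x})" for x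
    have ge: "height P s + card (X \<inter> {s<..x}) \<le> f x" if "s < x" for s x
      unfolding f_def using that by (intro Max_ge) auto
    have attained: "\<exists>s<x. f x = height P s + card (X \<inter> {s<..x})" if "x \<in> X" for x
    proof -
      have "x > 0" using that X by auto
      then have "f x \<in> (\<lambda>s. height P s + card (X \<inter> {s<..x})) ` {..<x}"
        unfolding f_def by (intro Max_in) auto
      then show ?thesis by auto
    qed
    have A: "?A f x" if x: "x \<in> X" for x
    proof
      have "X \<inter> {x - 1<..x} = {x}" using x X by auto
      moreover have "x - 1 < x" using x X by auto
      ultimately show "height P (x - 1) < f x" using ge[of "x - 1" x] by simp
      obtain s where "s < x" "f x = height P s + card (X \<inter> {s<..x})" using attained[OF x] by blast
      moreover have "x \<le> length P" using X x by auto
      ultimately show "f x \<le> height Q x" using R by (simp add: add.commute)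
    qed
    \<comment> \<open>The \<open>s\<close> attaining the maximum at \<open>x\<close> also competes
      at \<open>y\<close>, where its interval contains \<open>y\<close> in addition.\<close>
    have "f x < f y" if xy: "x \<in> X" "y \<in> X" "x < y" for x y
    proof -
      obtain s where s: "s < x" "f x = height P s + card (X \<inter> {s<..x})"
        using attained[OF xy(1)] by blast
      have "card (X \<inter> {s<..x}) < card (X \<inter> {s<..y})"
      proof (rule psubset_card_mono)
        have "y \<in> X \<inter> {s<..y}" "y \<notin> X \<inter> {s<..x}" using xy s by auto
        moreover have "X \<inter> {s<..x} \<subseteq> X \<inter> {s<..y}" using xy by auto
        ultimately show "X \<inter> {s<..x} \<subset> X \<inter> {s<..y}" by blast
      qed simp
      then show ?thesis using s ge[of s y] xy(3) by linarith
    qed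
    then have "inj_on f X" by (intro linorder_inj_onI) (auto simp: less_imp_neq)
    moreover have "f x \<in> {1..count_list P North}" if "x \<in> X" for x
      using A[OF that] height_le_count[of Q x] b(2) by auto
    ultimately show "\<exists>f. inj_on f X \<and> f ` X \<subseteq> {1..count_list P North} \<and> (\<forall>x\<in>X. ?A f x)"
      using A by blast
  qed
  ultimately show ?thesis by blast
qed

lemma indep_interval_le:
  assumes "bounding_paths P Q" "X \<in> indep (path_matroid P Q)" "s \<le> t" "t \<le> length P"
  shows "card (X \<inter> {s<..t}) + height P s \<le> height Q t"
  using assms indep_path_matroid_iff by blast

lemma card_interval_split:
  fixes s t u :: nat
  assumes "s \<le> t" "t \<le> u"
  shows "card (X \<inter> {s<..u}) = card (X \<inter> {s<..t}) + card (X \<inter> {t<..u})"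
proof -
  have "X \<inter> {s<..u} = (X \<inter> {s<..t}) \<union> (X \<inter> {t<..u})" using assms by auto
  then show ?thesis by (simp add: card_Un_disjoint disjoint_iff)
qed

text \<open>An interval count is a difference of two prefix counts, so bounding every prefix from
  both sides is enough. At full size this is also necessary, by
  \<open>indep_heights\<close>.\<close>

lemma indepI_heights:
  assumes PQ: "bounding_paths P Q" and X: "X \<subseteq> {1..length P}"
    and h: "\<And>t. t \<le> length P \<Longrightarrow>
      height P t \<le> card (X \<inter> {0<..t}) \<and> card (X \<inter> {0<..t}) \<le> height Q t"
  shows "X \<in> indep (path_matroid P Q)"
  unfolding indep_path_matroid_iff[OF PQ]
proof (intro conjI X allI impI)
  fix s t assume "s \<le> t" "t \<le> length P"
  then show "card (X \<inter> {s<..t}) + height P s \<le> height Q t"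
    using card_interval_split[of 0 s t X] h[of s] h[of t] by simp
qed

lemma inter_ground: "X \<subseteq> {1..n} \<Longrightarrow> X \<inter> {0<..n} = (X :: nat set)"
  by auto

lemma card_indep_le:
  assumes PQ: "bounding_paths P Q" and X: "X \<in> indep (path_matroid P Q)"
  shows "card X \<le> count_list P North"
proof -
  have X': "X \<subseteq> {1..length P}" using X indep_path_matroid_iff[OF PQ] by blast
  have "card (X \<inter> {0<..length P}) + height P 0 \<le> height Q (length P)"
    using X indep_path_matroid_iff[OF PQ] by blast
  then show ?thesis
    using bounding_pathsD[OF PQ] by (simp add: inter_ground[OF X'] height_beyond)
qed

text \<open>The interval criterion bounds the number of elements after \<open>t\<close> from above;
  as the total is full, this bounds the number up to \<open>t\<close> from below.\<close>

lemma indep_heights: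
  assumes PQ: "bounding_paths P Q" and X: "X \<in> indep (path_matroid P Q)"
    and card: "card X = count_list P North" and t: "t \<le> length P"
  shows "height P t \<le> card (X \<inter> {0<..t})" "card (X \<inter> {0<..t}) \<le> height Q t"
proof -
  have X': "X \<subseteq> {1..length P}"
    and R: "\<And>s t. s \<le> t \<Longrightarrow> t \<le> length P \<Longrightarrow> card (X \<inter> {s<..t}) + height P s \<le> height Q t"
    using X indep_path_matroid_iff[OF PQ] by blast+
  show "card (X \<inter> {0<..t}) \<le> height Q t" using R[of 0 t] t by simp
  show "height P t \<le> card (X \<inter> {0<..t})"
    using R[of t "length P"] t card_interval_split[of 0 t "length P" X] card
      bounding_pathsD[OF PQ] by (simp add: inter_ground[OF X'] height_beyond)
qed

text \<open>The positions of the North steps of \<open>P\<close> itself form such a set.\<close>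

lemma exists_full_indep:
  assumes PQ: "bounding_paths P Q"
  shows "\<exists>X\<in>indep (path_matroid P Q). card X = count_list P North"
proof -
  define X where "X = {j \<in> {1..length P}. P ! (j - 1) = North}"
  have X: "X \<subseteq> {1..length P}" by (auto simp: X_def)
  have c: "card (X \<inter> {0<..t}) = height P t" if "t \<le> length P" for t
    using that
  proof (induction t)
    case (Suc t)
    have "X \<inter> {t<..Suc t} = (if P ! t = North then {Suc t} else {})"
    proof -
      have "{t<..Suc t} = {Suc t}" by auto
      then show ?thesis using Suc.prems by (auto simp: X_def)
    qed
    then show ?case
      using Suc card_interval_split[of 0 t "Suc t" X] by (simp add: height_Suc)
  qed simp
  have "X \<in> indep (path_matroid P Q)"
    using c bounding_pathsD(3)[OF PQ] by (intro indepI_heights[OF PQ X]) simp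
  moreover have "card X = count_list P North"
    using c[of "length P"] by (simp add: inter_ground[OF X] height_beyond)
  ultimately show ?thesis by blast
qed

section \<open>Reversal\<close>

lemma height_rev:
  assumes "k \<le> length w"
  shows "height (rev w) k + height w (length w - k) = count_list w North"
proof -
  have "count_list w North = height w (length w - k) + count_list (drop (length w - k) w) North"
    unfolding height_def by (metis append_take_drop_id count_list_append)
  moreover have "height (rev w) k = count_list (drop (length w - k) w) North"
    by (simp add: height_def take_rev)
  ultimately show ?thesis by simp
qed

text \<open>Reversing words is a half turn of the region, which makes the upper path the lower
  one.\<close>

lemma bounding_paths_rev:
  assumes PQ: "bounding_paths P Q"
  shows "bounding_paths (rev Q) (rev P)"
proof (rule bounding_pathsI)
  note b = bounding_pathsD[OF PQ]
  fix k assume "k \<le> length (rev P)"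
  then show "height (rev Q) k \<le> height (rev P) k"
    using height_rev[of k P] height_rev[of k Q] b(1,2) b(3)[of "length P - k"] by simp
qed (use bounding_pathsD[OF PQ] in auto)

lemma card_reflect:
  fixes X :: "nat set"
  assumes X: "X \<subseteq> {1..n}" and t: "t \<le> n"
  shows "card ((\<lambda>j. Suc n - j) ` X \<inter> {s<..t}) = card (X \<inter> {n - t<..n - s})"
proof -
  have "(\<lambda>j. Suc n - j) ` X \<inter> {s<..t} = (\<lambda>j. Suc n - j) ` (X \<inter> {n - t<..n - s})"
    using X t by (auto simp: image_iff) (force dest: subsetD)+
  moreover have "inj_on (\<lambda>j. Suc n - j) (X \<inter> {n - t<..n - s})"
    using X by (auto simp: inj_on_def)
  ultimately show ?thesis by (simp add: card_image)
qed

text \<open>The interval criterion is invariant under the half turn that replaces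
  \<open>(s, t)\<close> by \<open>(n - t, n - s)\<close>. Elements are numbered from 1, so the
  reflection sends \<open>j\<close> to \<open>Suc n - j\<close>.\<close>

lemma iso_via_rev:
  assumes PQ: "bounding_paths P Q"
  shows "iso_via (\<lambda>j. Suc (length P) - j) (path_matroid P Q) (path_matroid (rev Q) (rev P))"
proof -
  note b = bounding_pathsD[OF PQ] and RQ = bounding_paths_rev[OF PQ]
  define n where "n = length P"
  define \<rho> where "\<rho> = (\<lambda>j. Suc n - j)"
  have n: "length P = n" "length Q = n" using b by (auto simp: n_def)
  have bij: "bij_betw \<rho> {1..n} {1..n}"
    by (rule bij_betw_byWitness[of _ \<rho>]) (auto simp: \<rho>_def)
  have "X \<in> indep (path_matroid P Q) \<longleftrightarrow> \<rho> ` X \<in> indep (path_matroid (rev Q) (rev P))"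
    if X: "X \<subseteq> {1..n}" for X
  proof -
    have "card (\<rho> ` X \<inter> {s<..t}) + height (rev Q) s \<le> height (rev P) t \<longleftrightarrow>
        card (X \<inter> {n - t<..n - s}) + height P (n - t) \<le> height Q (n - s)"
      if "s \<le> t" "t \<le> n" for s t
    proof -
      \<comment> \<open>Both sums equal the common number of North steps, which converts one
        inequality into the other.\<close>
      have "height (rev Q) s + height Q (n - s) = height (rev P) t + height P (n - t)"
        using height_rev[of s Q] height_rev[of t P] that n b(2) by simp
      then show ?thesis using card_reflect[OF X that(2), of s] unfolding \<rho>_def by linarith
    qed
    then have "(\<forall>s t. s \<le> t \<longrightarrow> t \<le> n \<longrightarrow>
          card (\<rho> ` X \<inter> {s<..t}) + height (rev Q) s \<le> height (rev P) t) \<longleftrightarrow>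
        (\<forall>s t. s \<le> t \<longrightarrow> t \<le> n \<longrightarrow>
          card (X \<inter> {n - t<..n - s}) + height P (n - t) \<le> height Q (n - s))"
      by blast
    also have "\<dots> \<longleftrightarrow> (\<forall>s t. s \<le> t \<longrightarrow> t \<le> n \<longrightarrow>
          card (X \<inter> {s<..t}) + height P s \<le> height Q t)" (is "?L \<longleftrightarrow> ?R")
    proof
      assume L: ?L
      show ?R
      proof (intro allI impI)
        fix s t assume "s \<le> t" "t \<le> n"
        then show "card (X \<inter> {s<..t}) + height P s \<le> height Q t"
          using L[rule_format, of "n - t" "n - s"] by simp
      qed
    qed simp
    finally show ?thesis
      unfolding indep_path_matroid_iff[OF PQ] indep_path_matroid_iff[OF RQ]
      using X bij_betw_imp_surj_on[OF bij] by (auto simp: n)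
  qed
  then show ?thesis
    unfolding iso_via_def using bij by (simp add: n \<rho>_def)
qed

section \<open>Notch paths\<close>

lemma length_catalan_path [simp]: "length (catalan_path m r) = m + r"
  by (simp add: catalan_path_def)

lemma length_notch_path [simp]: "1 \<le> m \<Longrightarrow> 1 \<le> r \<Longrightarrow> length (notch_path m r) = m + r"
  by (simp add: notch_path_def)

lemma count_list_replicate: "count_list (replicate n x) y = (if x = y then n else 0)"
  by (induction n) auto

lemma count_catalan_path [simp]: "count_list (catalan_path m r) North = r"
  by (simp add: catalan_path_def count_list_replicate)

lemma count_notch_path [simp]: "1 \<le> r \<Longrightarrow> count_list (notch_path m r) North = r"
  by (simp add: notch_path_def count_list_replicate)

lemma height_catalan_path: "k \<le> m + r \<Longrightarrow> height (catalan_path m r) k = k - m"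
  by (auto simp: height_def catalan_path_def count_list_replicate min_def)

text \<open>Compared with \<open>height_catalan_path\<close>, only the height at \<open>m\<close>
  changes, from 0 to 1.\<close>

lemma height_notch_path:
  assumes "1 \<le> m" "1 \<le> r" "k \<le> m + r"
  shows "height (notch_path m r) k = (if k = m then 1 else k - m)"
proof -
  consider "k < m" | "k = m" | d where "k = Suc (m + d)"
    using less_imp_Suc_add[of m k] by (meson linorder_neqE_nat)
  then show ?thesis
    using assms by cases (auto simp: height_def notch_path_def count_list_replicate min_def take_Cons' Suc_diff_le)
qed

text \<open>Prefix counts for one exchange in the set of elements after \<open>m\<close>; the
  removed element is added on the left to avoid truncated subtraction. Used both to verify that
  exchanges are independent and to read off the paths from them.\<close>

lemma card_exchanged_interval:
  fixes y m h n t :: nat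
  assumes "1 \<le> y" "y \<le> m" "m < h" "h \<le> n" "t \<le> n"
  shows "card (insert y ({m<..n} - {h}) \<inter> {0<..t}) + (if h \<le> t then 1 else 0) =
    (if y \<le> t then 1 else 0) + (t - m)"
proof -
  have eq: "insert y ({m<..n} - {h}) \<inter> {0<..t} =
      (if y \<le> t then insert y ({m<..t} - {h}) else {m<..t} - {h})"
    using assms by auto
  have "card ({m<..t} - {h}) + (if h \<le> t then 1 else 0) = t - m"
    using assms by (auto simp: card_Diff_singleton_if)
  moreover have "y \<notin> {m<..t} - {h}" using assms by auto
  ultimately show ?thesis unfolding eq by auto
qed

text \<open>Where the paths touch, the matroid splits as a direct sum. A circuit through the first
  and the last element would be cut into two independent pieces, and these combine to an independent
  set.\<close>

lemma connected_imp_strictly_between: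
  assumes PQ: "bounding_paths P Q" and conn: "connected_matroid (path_matroid P Q)"
    and t: "0 < t" "t < length P"
  shows "height P t < height Q t"
proof (rule ccontr)
  assume "\<not> height P t < height Q t"
  then have eq: "height P t = height Q t" using bounding_pathsD(3)[OF PQ, of t] by linarith
  let ?n = "length P"
  have "1 \<in> {1..?n}" "?n \<in> {1..?n}" "1 \<noteq> ?n" using t by auto
  then obtain C where C: "circuit (path_matroid P Q) C" "1 \<in> C" "?n \<in> C"
    using conn unfolding connected_matroid_def by (metis ground_path_matroid)
  have sub: "C \<subseteq> {1..?n}" using C(1) unfolding circuit_def by simp
  have dep: "C \<notin> indep (path_matroid P Q)" using C(1) unfolding circuit_def by simp
  have "?n \<notin> {0<..t}" "1 \<notin> {t<..?n}" using t by auto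
  then have "C \<inter> {0<..t} \<subset> C" "C \<inter> {t<..?n} \<subset> C" using C(2,3) by blast+
  then have I: "C \<inter> {0<..t} \<in> indep (path_matroid P Q)" "C \<inter> {t<..?n} \<in> indep (path_matroid P Q)"
    using C(1) unfolding circuit_def by blast+
  have le1: "card (C \<inter> {a<..b}) + height P a \<le> height Q b" if "a \<le> b" "b \<le> t" for a b
  proof -
    have "C \<inter> {0<..t} \<inter> {a<..b} = C \<inter> {a<..b}" using that by auto
    then show ?thesis using indep_interval_le[OF PQ I(1), of a b] that t by simp
  qed
  have le2: "card (C \<inter> {a<..b}) + height P a \<le> height Q b" if "t \<le> a" "a \<le> b" "b \<le> ?n" for a b
  proof -
    have "C \<inter> {t<..?n} \<inter> {a<..b} = C \<inter> {a<..b}" using that by auto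
    then show ?thesis using indep_interval_le[OF PQ I(2), of a b] that by simp
  qed
  have "card (C \<inter> {a<..b}) + height P a \<le> height Q b" if ab: "a \<le> b" "b \<le> ?n" for a b
  proof -
    consider "b \<le> t" | "t \<le> a" | "a \<le> t" "t \<le> b" by linarith
    then show ?thesis
    proof cases
      \<comment> \<open>The bounds for the two pieces add up because \<open>height Q t\<close> and
        \<open>height P t\<close> cancel.\<close>
      case 3
      then show ?thesis
        using card_interval_split[of a t b C] le1[of a t] le2[of t b] ab eq by simp
    qed (use le1 le2 ab in auto)
  qed
  then show False using dep sub indep_path_matroid_iff[OF PQ] by blast
qed

text \<open>The notch demands one element among the first \<open>m\<close>, where the candidate set
  has none. Any exchange supplies exactly that element.\<close>

lemma notch_near_basis:
  assumes mr: "1 \<le> m" "1 \<le> r" and PQ: "bounding_paths (notch_path m r) Q"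
    and conn: "connected_matroid (path_matroid (notch_path m r) Q)"
  shows "near_basis (path_matroid (notch_path m r) Q) {m<..m + r}"
proof -
  let ?P = "notch_path m r" and ?H = "{m<..m + r}"
  note b = bounding_pathsD[OF PQ]
  have "?H \<notin> indep (path_matroid ?P Q)"
  proof
    assume "?H \<in> indep (path_matroid ?P Q)"
    then have "height ?P m \<le> card (?H \<inter> {0<..m})"
      using mr by (intro indep_heights[OF PQ]) auto
    moreover have "?H \<inter> {0<..m} = {}" by auto
    ultimately show False using mr by (simp add: height_notch_path)
  qed
  moreover have "insert y (?H - {h}) \<in> indep (path_matroid ?P Q)"
    if h: "h \<in> ?H" and y: "y \<in> {1..m + r} - ?H" for h y
  proof (rule indepI_heights[OF PQ])
    show "insert y (?H - {h}) \<subseteq> {1..length ?P}" using y mr by auto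
    fix t assume "t \<le> length ?P"
    then have t: "t \<le> m + r" using mr by simp
    have c: "card (insert y (?H - {h}) \<inter> {0<..t}) + (if h \<le> t then 1 else 0) =
        (if y \<le> t then 1 else 0) + (t - m)"
      using h y t by (intro card_exchanged_interval) auto
    have p: "height ?P t = (if t = m then 1 else t - m)" by (rule height_notch_path[OF mr t])
    \<comment> \<open>An exchange exceeds the lower path by at most one at every prefix, so strict
      separation of the paths gives the upper bound.\<close>
    have q: "0 < t \<Longrightarrow> t < m + r \<Longrightarrow> height ?P t < height Q t"
      using connected_imp_strictly_between[OF PQ conn] mr by simp
    show "height ?P t \<le> card (insert y (?H - {h}) \<inter> {0<..t}) \<and>
        card (insert y (?H - {h}) \<inter> {0<..t}) \<le> height Q t"
      using c p q b(3)[of t] h y t by (auto split: if_splits)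
  qed
  moreover have "?H \<subset> {1..m + r}" using mr by fastforce
  moreover have "card X \<le> card ?H" if "X \<in> indep (path_matroid ?P Q)" for X
    using card_indep_le[OF PQ that] mr by simp
  ultimately show ?thesis using mr by (simp add: near_basis_def)
qed

text \<open>The exchanged sets are bases, so their prefix counts bound \<open>P\<close> and
  \<open>Q\<close>. These bounds determine first \<open>H\<close>, then every height of
  \<open>P\<close>, and finally keep \<open>Q\<close> high enough that lowering \<open>P\<close> at
  the notch adds no independent set but \<open>H\<close>.\<close>

lemma near_basis_below_imp_notch:
  assumes PQ: "bounding_paths P Q" and nb: "near_basis (path_matroid P Q) H"
    and low: "t0 \<le> length P" "card (H \<inter> {0<..t0}) < height P t0"
  shows "\<exists>m r. 1 \<le> m \<and> 1 \<le> r \<and> P = notch_path m r \<and> bounding_paths (catalan_path m r) Q \<and>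
    indep (path_matroid (catalan_path m r) Q) = insert H (indep (path_matroid P Q))"
proof -
  note b = bounding_pathsD[OF PQ]
  define n r where "n = length P" and "r = count_list P North"
  have H: "H \<subset> {1..n}" "H \<notin> indep (path_matroid P Q)"
    "\<And>X. X \<in> indep (path_matroid P Q) \<Longrightarrow> card X \<le> card H"
    "\<And>h y. h \<in> H \<Longrightarrow> y \<in> {1..n} - H \<Longrightarrow> insert y (H - {h}) \<in> indep (path_matroid P Q)"
    using nb unfolding near_basis_def by (auto simp: n_def)
  have finH: "finite H" using H(1) finite_subset by blast
  have "card H \<ge> r" using exists_full_indep[OF PQ] H(3) unfolding r_def by metis
  moreover have "0 < r" using low height_le_count[of P t0] by (simp add: r_def)
  ultimately obtain h0 where h0: "h0 \<in> H" by fastforce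
  obtain y0 where y0: "y0 \<in> {1..n} - H" using H(1) by blast
  have swap_card: "card (insert y (H - {h})) = card H" if "h \<in> H" "y \<notin> H" for h y
    using card_exchange_element[OF finH that] .
  have "card H \<le> r"
    using card_indep_le[OF PQ H(4)[OF h0 y0]] swap_card[OF h0] y0 by (simp add: r_def)
  then have cardH: "card H = r" using \<open>card H \<ge> r\<close> by simp
  have swap: "height P t \<le> card (insert y (H - {h}) \<inter> {0<..t})"
    "card (insert y (H - {h}) \<inter> {0<..t}) \<le> height Q t"
    if "h \<in> H" "y \<in> {1..n} - H" "t \<le> n" for h y t
    using indep_heights[OF PQ H(4)[OF that(1,2)]] that swap_card cardH by (auto simp: r_def n_def)
  \<comment> \<open>Every exchange must raise the count up to \<open>t0\<close>, which forces \<open>H\<close> to lie beyond \<open>t0\<close>.\<close>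
  have sides: "t0 < h \<and> y \<le> t0" if hy: "h \<in> H" "y \<in> {1..n} - H" for h y
  proof (rule ccontr)
    assume neg: "\<not> (t0 < h \<and> y \<le> t0)"
    have "card (insert y (H - {h}) \<inter> {0<..t0}) \<le> card (H \<inter> {0<..t0})"
    proof (cases "y \<le> t0")
      case False
      then have "insert y (H - {h}) \<inter> {0<..t0} \<subseteq> H \<inter> {0<..t0}" by auto
      then show ?thesis by (intro card_mono) auto
    next
      \<comment> \<open>Here \<open>neg\<close> forces \<open>h\<close> to lie among the first
        \<open>t0\<close> elements too, so the gain of \<open>y\<close> is offset by the loss of
        \<open>h\<close>.\<close>
      case True
      have fin: "finite (H \<inter> {0<..t0})" by simp
      have hin: "h \<in> H \<inter> {0<..t0}" using True neg hy H(1) by auto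
      have "insert y (H - {h}) \<inter> {0<..t0} \<subseteq> insert y (H \<inter> {0<..t0} - {h})" by auto
      then have "card (insert y (H - {h}) \<inter> {0<..t0}) \<le> card (insert y (H \<inter> {0<..t0} - {h}))"
        by (intro card_mono) auto
      also have "\<dots> \<le> Suc (card (H \<inter> {0<..t0} - {h}))" by (rule card_insert_le_m1) auto
      also have "\<dots> = card (H \<inter> {0<..t0})" using card_Suc_Diff1[OF fin hin] .
      finally show ?thesis .
    qed
    then show False using swap(1)[OF hy, of t0] low by (simp add: n_def)
  qed
  define m where "m = t0"
  \<comment> \<open>Fixing \<open>y0\<close> and varying \<open>h\<close> puts \<open>H\<close>
    beyond \<open>m\<close>; fixing \<open>h0\<close> and varying \<open>y\<close> puts its
    complement within the first \<open>m\<close>.\<close>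
  have Heq: "H = {m<..n}"
  proof (intro subset_antisym subsetI)
    fix x assume "x \<in> H"
    then show "x \<in> {m<..n}" using sides[OF _ y0] H(1) by (auto simp: m_def)
  next
    fix x assume "x \<in> {m<..n}"
    then show "x \<in> H" using sides[OF h0, of x] by (auto simp: m_def)
  qed
  have n: "n = m + r" using cardH Heq low by (simp add: m_def n_def)
  have m1: "1 \<le> m" using y0 Heq by auto
  have r1: "1 \<le> r" using \<open>0 < r\<close> by simp
  \<comment> \<open>Inserting \<open>m\<close>, the last element outside \<open>H\<close>, delays
    the gain as long as possible and so gives the sharpest bounds on \<open>P\<close>.\<close>
  have c: "card (insert m ({m<..n} - {h}) \<inter> {0<..t}) + (if h \<le> t then 1 else 0) =
      (if m \<le> t then 1 else 0) + (t - m)" if "h \<in> H" "t \<le> n" for h t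
    using that m1 Heq by (intro card_exchanged_interval) auto
  have mH: "m \<in> {1..n} - H" using m1 n Heq by auto
  have Pn: "height P n = r" by (simp add: n_def r_def height_beyond)
  \<comment> \<open>\<open>P\<close> still has to climb to \<open>r\<close> in the remaining
    \<open>n - t\<close> steps, by at most one per step.\<close>
  have lower: "t - m \<le> height P t" if "t \<le> n" for t
  proof -
    have "height P (t + k) \<le> height P t + k" for k
    proof (induction k)
      case (Suc k)
      then show ?case using height_step(2)[of P "t + k"] by simp
    qed simp
    from this[of "n - t"] show ?thesis using that Pn n by simp
  qed
  have Pm: "height P m \<ge> 1" using low by (simp add: m_def)
  have upper: "height P t \<le> (if t = m then 1 else t - m)" if t: "t \<le> n" for t
  proof -
    \<comment> \<open>Removing the first element of \<open>H\<close> cancels the gain immediately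
      after \<open>m\<close>.\<close>
    have 1: "Suc m \<in> H" using Heq n r1 by auto
    show ?thesis using swap(1)[OF 1 mH t] c[OF 1 t] unfolding Heq
      by (cases "t = m") (auto split: if_splits)
  qed
  have hP: "height P t = (if t = m then 1 else t - m)" if "t \<le> n" for t
    using upper[OF that] lower[OF that] Pm by (auto split: if_splits)
  have P: "P = notch_path m r"
    using m1 r1 n hP by (intro path_eqI) (auto simp: n_def height_notch_path)
  let ?C = "catalan_path m r"
  have hC: "height ?C t = t - m" if "t \<le> n" for t using that n by (simp add: height_catalan_path)
  have CQ: "bounding_paths ?C Q"
  proof (rule bounding_pathsI)
    fix k assume "k \<le> length Q"
    then have "k \<le> n" using b(1) by (simp add: n_def)
    then show "height ?C k \<le> height Q k" using hC lower b(3)[of k] by (metis order_trans)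
  qed (use b n in \<open>auto simp: n_def r_def\<close>)
  \<comment> \<open>Removing the last element \<open>n\<close> instead keeps the gain visible up to
    \<open>n - 1\<close>, which pushes \<open>Q\<close> up.\<close>
  have Qgt: "t - m < height Q t" if t: "m \<le> t" "t < n" for t
  proof -
    have nH: "n \<in> H" using Heq n r1 by auto
    show ?thesis using swap(2)[OF nH mH, of t] c[OF nH, of t] t unfolding Heq by auto
  qed
  have "indep (path_matroid ?C Q) = insert H (indep (path_matroid P Q))"
  proof (intro subset_antisym subsetI)
    fix X assume "X \<in> indep (path_matroid ?C Q)"
    then have X: "X \<subseteq> {1..n}" "card X \<le> r"
      and XC: "\<And>s t. s \<le> t \<Longrightarrow> t \<le> n \<Longrightarrow> card (X \<inter> {s<..t}) + height ?C s \<le> height Q t"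
      using indep_path_matroid_iff[OF CQ] card_indep_le[OF CQ] n by auto
    have finX: "finite X" using X(1) finite_subset by blast
    show "X \<in> insert H (indep (path_matroid P Q))"
    proof (cases "H \<subseteq> X")
      case True
      then show ?thesis using card_seteq[OF finX True] X(2) cardH by simp
    next
      case False
      have "card (X \<inter> {s<..t}) + height P s \<le> height Q t" if st: "s \<le> t" "t \<le> n" for s t
      \<comment> \<open>The two lower paths differ only at \<open>m\<close>, so only intervals
        starting there have a stricter bound. It holds by \<open>Qgt\<close> if the interval ends
        before \<open>n\<close>, and for \<open>t = n\<close> because \<open>X\<close> misses an
        element of \<open>H\<close>.\<close>
      proof (cases "s = m")
        case sm: True
        have "card (X \<inter> {m<..t}) < height Q t"
        proof (cases "t = n")
          case True
          have "X \<inter> {m<..n} \<subset> H" using False Heq by auto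
          then have "card (X \<inter> {m<..n}) < r" using psubset_card_mono[OF finH] cardH by blast
          then show ?thesis using True b by (simp add: n_def r_def height_beyond)
        next
          case False
          have "card (X \<inter> {m<..t}) \<le> card {m<..t}" by (intro card_mono) auto
          then show ?thesis using Qgt[of t] st sm False by simp
        qed
        then show ?thesis using sm hP[of m] n by simp
      next
        case False
        then show ?thesis using XC[OF st] hP[of s] hC[of s] st by simp
      qed
      then show ?thesis using X indep_path_matroid_iff[OF PQ] by (simp add: n_def)
    qed
  next
    fix X assume "X \<in> insert H (indep (path_matroid P Q))"
    then consider "X = H" | "X \<in> indep (path_matroid P Q)" by blast
    then show "X \<in> indep (path_matroid ?C Q)"
    proof cases
      case 1
      \<comment> \<open>\<open>H\<close> is the set of North steps of the Catalan path, so its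
        prefix counts follow the lower boundary exactly.\<close>
      have "X \<inter> {0<..t} = {m<..t}" if "t \<le> n" for t using that 1 Heq by auto
      then show ?thesis
        using 1 H(1) n bounding_pathsD(3)[OF CQ] hC
        by (intro indepI_heights[OF CQ]) (auto, metis)
    next
      case 2
      have "card (X \<inter> {s<..t}) + height ?C s \<le> height Q t" if "s \<le> t" "t \<le> n" for s t
        using indep_interval_le[OF PQ 2, of s t] hC[of s] lower[of s] that by (simp add: n_def)
      moreover have "X \<subseteq> {1..n}" using 2 indep_path_matroid_subset by (fastforce simp: n_def)
      ultimately show ?thesis unfolding indep_path_matroid_iff[OF CQ] by (simp add: n)
    qed
  qed
  then show ?thesis using m1 r1 P CQ by blast
qed

section \<open>From path presentations back to abstract matroids\<close>

lemma lattice_path_circuit_hyperplane: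
  fixes M :: "'a set_system"
  assumes lpm: "lattice_path_matroid M" and ch: "circuit_hyperplane M H"
  shows "notch_matroid M" "generalized_catalan_matroid (relaxation M H)"
proof -
  have M: "matroid M" using lpm unfolding lattice_path_matroid_def by simp
  have circ: "circuit M H" using ch unfolding circuit_hyperplane_def by simp
  have HM: "H \<subseteq> ground M" using circ unfolding circuit_def by simp
  have MP: "indep M \<subseteq> Pow (ground M)" using matroidD(2)[OF M] by blast
  have nbM: "near_basis M H" using circuit_hyperplane_iff[OF M] ch by simp
  \<comment> \<open>Normalises the presentation so that the image of \<open>H\<close> violates a
    lower bound.\<close>
  have "\<exists>\<phi> P Q t. bounding_paths P Q \<and> iso_via \<phi> M (path_matroid P Q) \<and> t \<le> length P \<and>
      card (\<phi> ` H \<inter> {0<..t}) < height P t"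
  proof -
    obtain P Q \<phi> where PQ: "bounding_paths P Q" and iso: "iso_via \<phi> M (path_matroid P Q)"
      using lpm unfolding lattice_path_matroid_def isomorphic_iff by blast
    note b = bounding_pathsD[OF PQ]
    let ?n = "length P" and ?H = "\<phi> ` H"
    have nb: "near_basis (path_matroid P Q) ?H"
      using near_basis_iso[OF iso MP indep_path_matroid_subset HM] nbM by simp
    then have H: "?H \<subseteq> {1..?n}" "?H \<notin> indep (path_matroid P Q)"
      "\<And>X. X \<in> indep (path_matroid P Q) \<Longrightarrow> card X \<le> card ?H"
      unfolding near_basis_def by auto
    \<comment> \<open>If every prefix count lay between the two heights, the image of
      \<open>H\<close> would be independent.\<close>
    obtain t where t: "t \<le> ?n"
      "card (?H \<inter> {0<..t}) < height P t \<or> height Q t < card (?H \<inter> {0<..t})"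
      using indepI_heights[OF PQ H(1)] H(2) by (meson not_le)
    \<comment> \<open>If \<open>H\<close> violates the upper bound, then its reversal violates the lower bound.\<close>
    show ?thesis
    proof (cases "card (?H \<inter> {0<..t}) < height P t")
      case True
      then show ?thesis using PQ iso t by blast
    next
      case False
      then have gt: "height Q t < card (?H \<inter> {0<..t})" using t by simp
      let ?\<psi> = "(\<lambda>j. Suc ?n - j) \<circ> \<phi>"
      have iso': "iso_via ?\<psi> M (path_matroid (rev Q) (rev P))"
        using iso_via_trans[OF iso iso_via_rev[OF PQ]] .
      \<comment> \<open>With more than \<open>height Q t\<close> of at most \<open>r\<close>
        elements among the first \<open>t\<close>, where \<open>r\<close> is the number of North
        steps, fewer than \<open>r - height Q t\<close> come later; these are the ones that the
        reflection moves to the front.\<close>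
      have "card (?\<psi> ` H \<inter> {0<..?n - t}) = card (?H \<inter> {t<..?n})"
        using card_reflect[OF H(1), of "?n - t" 0] t by (simp add: image_comp)
      moreover have "card (?H \<inter> {t<..?n}) + card (?H \<inter> {0<..t}) = card ?H"
        using card_interval_split[of 0 t ?n ?H] t inter_ground[OF H(1)] by simp
      moreover have "card ?H \<le> count_list P North"
      proof -
        obtain y where y: "y \<in> {1..?n} - ?H"
          using nb psubset_imp_ex_mem[of ?H "{1..?n}"] unfolding near_basis_def by auto
        obtain h where h: "h \<in> ?H" using gt by (cases "?H = {}") auto
        have "insert y (?H - {h}) \<in> indep (path_matroid P Q)"
          using nb h y unfolding near_basis_def ground_path_matroid by blast
        moreover have "finite ?H" using H(1) finite_subset by blast
        then have "card (insert y (?H - {h})) = card ?H"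
          using y h by (intro card_exchange_element) auto
        ultimately show ?thesis using card_indep_le[OF PQ] by metis
      qed
      moreover have "height (rev Q) (?n - t) + height Q t = count_list P North"
        using height_rev[of "?n - t" Q] b t by simp
      ultimately have "card (?\<psi> ` H \<inter> {0<..?n - t}) < height (rev Q) (?n - t)"
        using gt by linarith
      then show ?thesis
        using bounding_paths_rev[OF PQ] iso' b(1)
        by (intro exI[of _ ?\<psi>] exI[of _ "rev Q"] exI[of _ "rev P"] exI[of _ "?n - t"]) simp
    qed
  qed
  then obtain \<phi> P Q t where PQ: "bounding_paths P Q" and iso: "iso_via \<phi> M (path_matroid P Q)"
    and t: "t \<le> length P" "card (\<phi> ` H \<inter> {0<..t}) < height P t" by blast
  have nb: "near_basis (path_matroid P Q) (\<phi> ` H)"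
    using near_basis_iso[OF iso MP indep_path_matroid_subset HM] nbM by simp
  obtain m r where mr: "1 \<le> m" "1 \<le> r" "P = notch_path m r" "bounding_paths (catalan_path m r) Q"
    and ind: "indep (path_matroid (catalan_path m r) Q) = insert (\<phi> ` H) (indep (path_matroid P Q))"
    using near_basis_below_imp_notch[OF PQ nb t] by blast
  show "notch_matroid M"
    unfolding notch_matroid_def isomorphic_iff using M mr PQ iso by blast
  \<comment> \<open>The same bijection serves the relaxation, since each side gains one independent
    set and \<open>\<phi>\<close> matches the two.\<close>
  have "iso_via \<phi> (relaxation M H) (path_matroid (catalan_path m r) Q)"
    unfolding iso_via_def indep_relaxation[OF M circ] ind
  proof (intro conjI allI impI)
    show "bij_betw \<phi> (ground (relaxation M H)) (ground (path_matroid (catalan_path m r) Q))"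
      using iso_viaD(1)[OF iso] mr by (simp add: relaxation_def)
    fix X assume "X \<subseteq> ground (relaxation M H)"
    then have X: "X \<subseteq> ground M" by (simp add: relaxation_def)
    show "X \<in> insert H (indep M) \<longleftrightarrow> \<phi> ` X \<in> insert (\<phi> ` H) (indep (path_matroid P Q))"
      using iso_viaD(4)[OF iso X] inj_on_image_eq_iff[OF iso_viaD(2)[OF iso] X HM] by simp
  qed
  then show "generalized_catalan_matroid (relaxation M H)"
    unfolding generalized_catalan_matroid_def isomorphic_iff
    using matroid_relaxation[OF M ch] mr by blast
qed

text \<open>As \<open>M\<close> is not generalized Catalan, the presentation must use a notch path,
  and the set of the last \<open>r\<close> elements is pulled back along the isomorphism.\<close>

lemma connected_notch_circuit_hyperplane:
  fixes M :: "'a set_system"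
  assumes conn: "connected_matroid M" and notcat: "\<not> generalized_catalan_matroid M"
    and notch: "notch_matroid M"
  shows "\<exists>H. circuit_hyperplane M H"
proof -
  have M: "matroid M" using notch unfolding notch_matroid_def by simp
  have MP: "indep M \<subseteq> Pow (ground M)" using matroidD(2)[OF M] by blast
  obtain m r Q \<phi> where mr: "1 \<le> m" "1 \<le> r" and PQ: "bounding_paths (notch_path m r) Q"
    and iso: "iso_via \<phi> M (path_matroid (notch_path m r) Q)" (is "iso_via \<phi> M ?N")
    using notch notcat
    unfolding notch_matroid_def generalized_catalan_matroid_def isomorphic_iff by blast
  have nb: "near_basis ?N {m<..m + r}"
    using notch_near_basis[OF mr PQ connected_matroid_iso[OF iso conn]] .
  then have "{m<..m + r} \<subseteq> \<phi> ` ground M"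
    unfolding near_basis_def iso_viaD(3)[OF iso] by blast
  then obtain H where H: "H \<subseteq> ground M" "{m<..m + r} = \<phi> ` H" by (meson subset_imageE)
  then have "near_basis M H"
    using near_basis_iso[OF iso MP indep_path_matroid_subset H(1)] nb by simp
  then show ?thesis using circuit_hyperplane_iff[OF M] by blast
qed

theorem theorem8p3:
  fixes M :: "'a set_system"
  assumes "lattice_path_matroid M"
  shows "(connected_matroid M \<and> \<not> generalized_catalan_matroid M \<longrightarrow>
            (notch_matroid M \<longleftrightarrow> (\<exists>H. circuit_hyperplane M H))) \<and>
         (\<forall>H. circuit_hyperplane M H \<longrightarrow> generalized_catalan_matroid (relaxation M H))"
  using lattice_path_circuit_hyperplane[OF assms] connected_notch_circuit_hyperplane[of M] by metis

end
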